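(* Let $\alpha,\beta\in\mathbb{K}^*$ be roots of unity with $\alpha\beta\neq1$, and let $\underline{\mu}=(\mu_1,\mu_2)$ and $\underline{\lambda}=(\lambda_1,\lambda_2)$ be in $(\mathbb{K}^* )^2$. Then $\mathscr{V}_3(\underline{\mu})$ is isomorphic to $\mathscr{V}_3(\underline{\lambda})$ as $M_2(\alpha,\beta)$-modules if and only if $$\mu_1^{l_2}=\lambda_1^{l_2},\quad \mu_2=\lambda_2(\alpha^{-1}\beta)^{v}$$ holds for some integer $v$ such that $0\le v\le l_2-1$.
   Context: $\mathbb{K}$ is an algebraically closed field of arbitrary characteristic and $\mathbb{K}^*=\mathbb{K}\setminus\{0\}$; all modules are right modules. For a root of unity $\xi\in\mathbb{K}^*$, $\operatorname{ord}(\xi)$ is its order in the group $\mathbb{K}^*$. For $\alpha,\beta\in\mathbb{K}^*$, the two-parameter quantum matrix algebra $M_2(\alpha,\beta)$ is the associative unital $\mathbb{K}$-algebra generated by $X_{11},X_{12},X_{21},X_{22}$ subject to the relations $X_{12}X_{11}=\alpha X_{11}X_{12}$, $X_{22}X_{21}=\alpha X_{21}X_{22}$, $X_{21}X_{11}=\beta X_{11}X_{21}$, $X_{22}X_{12}=\beta X_{12}X_{22}$, $X_{21}X_{12}=\beta\alpha^{-1}X_{12}X_{21}$, $X_{22}X_{11}-X_{11}X_{22}=(\beta-\alpha^{-1})X_{12}X_{21}$. Set $l_2:=\operatorname{ord}(\alpha\beta^{-1})$. $\mathscr{V}_3(\underline{\mu})$ is the $\mathbb{K}$-vector space with basis $\{e(a,b):0\le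 a\le\operatorname{ord}(\alpha\beta)-1,\ 0\le b\le l_2-1\}$ and $M_2(\alpha,\beta)$-action (which does define a module structure) $$e(a,b)X_{11}=\begin{cases}\mu_2\alpha^{-1}(\alpha^{-1}\beta)^b[(\alpha\beta)^a-1]e(a-1,b)& a\neq0\\ 0& a=0\end{cases}$$ $$e(a,b)X_{12}=\mu_1^{-1}\mu_2\beta^a(\alpha^{-1}\beta)^be(a,b\dotplus(-1)),\qquad e(a,b)X_{21}=\mu_1\alpha^ae(a,b\dotplus1),$$ $$e(a,b)X_{22}=\begin{cases}e(a+1,b)& a\neq\operatorname{ord}(\alpha\beta)-1\\ 0& a=\operatorname{ord}(\alpha\beta)-1\end{cases}$$ where $\dotplus$ is addition modulo $l_2$. *)

theory Defs
  imports "HOL-Algebra.Algebra" "HOL-Algebra.Algebraic_Closure_Type" "HOL-Library.Poly_Mapping"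
begin

section \<open>Right modules over a (not necessarily commutative) ring\<close>

text \<open>
  The library's locale \<^locale>\<open>module\<close> is about left modules over commutative rings. We keep its
  record type, but read \<open>r \<odot>\<^bsub>M\<^esub> x\<close> as the right action \<open>x \<cdot> r\<close>. The record fields \<open>mult\<close> and \<open>one\<close>
  of a module are never used.
\<close>

locale right_module = R?: ring R + M?: abelian_group M
  for R :: "('a, 'm) ring_scheme" (structure) and M :: "('a, 'b, 'n) module_scheme" (structure) +
  assumes act_closed:
      "\<lbrakk>r \<in> carrier R; x \<in> carrier M\<rbrakk> \<Longrightarrow> r \<odot>\<^bsub>M\<^esub> x \<in> carrier M"
    and act_add_ring:
      "\<lbrakk>r \<in> carrier R; s \<in> carrier R; x \<in> carrier M\<rbrakk> \<Longrightarrow>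
        (r \<oplus>\<^bsub>R\<^esub> s) \<odot>\<^bsub>M\<^esub> x = r \<odot>\<^bsub>M\<^esub> x \<oplus>\<^bsub>M\<^esub> s \<odot>\<^bsub>M\<^esub> x"
    and act_add:
      "\<lbrakk>r \<in> carrier R; x \<in> carrier M; y \<in> carrier M\<rbrakk> \<Longrightarrow>
        r \<odot>\<^bsub>M\<^esub> (x \<oplus>\<^bsub>M\<^esub> y) = r \<odot>\<^bsub>M\<^esub> x \<oplus>\<^bsub>M\<^esub> r \<odot>\<^bsub>M\<^esub> y"
    and act_mult:
      "\<lbrakk>r \<in> carrier R; s \<in> carrier R; x \<in> carrier M\<rbrakk> \<Longrightarrow>
        (r \<otimes>\<^bsub>R\<^esub> s) \<odot>\<^bsub>M\<^esub> x = s \<odot>\<^bsub>M\<^esub> (r \<odot>\<^bsub>M\<^esub> x)"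
    and act_one:
      "x \<in> carrier M \<Longrightarrow> \<one>\<^bsub>R\<^esub> \<odot>\<^bsub>M\<^esub> x = x"

definition right_module_hom ::
    "('a, 'm) ring_scheme \<Rightarrow> ('a, 'b, 'n) module_scheme \<Rightarrow> ('a, 'c, 'o) module_scheme \<Rightarrow> ('b \<Rightarrow> 'c) set" where
  "right_module_hom R M N =
    {f \<in> carrier M \<rightarrow> carrier N.
      (\<forall>x\<in>carrier M. \<forall>y\<in>carrier M. f (x \<oplus>\<^bsub>M\<^esub> y) = f x \<oplus>\<^bsub>N\<^esub> f y) \<and>
      (\<forall>r\<in>carrier R. \<forall>x\<in>carrier M. f (r \<odot>\<^bsub>M\<^esub> x) = r \<odot>\<^bsub>N\<^esub> f x)}"

definition right_module_isomorphic ::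
    "('a, 'm) ring_scheme \<Rightarrow> ('a, 'b, 'n) module_scheme \<Rightarrow> ('a, 'c, 'o) module_scheme \<Rightarrow> bool" where
  "right_module_isomorphic R M N \<longleftrightarrow>
    (\<exists>f\<in>right_module_hom R M N. bij_betw f (carrier M) (carrier N))"


section \<open>Order of a root of unity\<close>

definition unit_ord :: "'k::field \<Rightarrow> nat" where
  "unit_ord \<xi> = group.ord (Multiplicative_Group.mult_of (ring_of_type_algebra :: 'k ring)) \<xi>"


section \<open>Free algebras and the two-parameter quantum matrix algebra\<close>

text \<open>
  \<open>'g word\<close> is the free monoid on \<open>'g\<close>, written additively, so that the convolution
  product makes \<open>'g word \<Rightarrow>\<^sub>0 'k\<close> the free associative unital algebra on \<open>'g\<close>.
\<close>

datatype 'g word = Word (letters: "'g list")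

instantiation word :: (type) monoid_add
begin

definition zero_word :: "'a word" where
  "0 = Word []"

definition plus_word :: "'a word \<Rightarrow> 'a word \<Rightarrow> 'a word" where
  "v + w = Word (letters v @ letters w)"

instance
  by standard (simp_all add: zero_word_def plus_word_def)

end

type_synonym ('g, 'k) free_alg = "'g word \<Rightarrow>\<^sub>0 'k"

definition scalar :: "'k \<Rightarrow> ('g, 'k::field) free_alg" where
  "scalar c = Poly_Mapping.single 0 c"

definition gen :: "'g \<Rightarrow> ('g, 'k::field) free_alg" where
  "gen g = Poly_Mapping.single (Word [g]) 1"

datatype mat_gen = X11 | X12 | X21 | X22

definition M2_relators :: "'k::field \<Rightarrow> 'k \<Rightarrow> (mat_gen, 'k) free_alg set" where
  "M2_relators \<alpha> \<beta> =
    {gen X12 * gen X11 - scalar \<alpha> * gen X11 * gen X12,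
     gen X22 * gen X21 - scalar \<alpha> * gen X21 * gen X22,
     gen X21 * gen X11 - scalar \<beta> * gen X11 * gen X21,
     gen X22 * gen X12 - scalar \<beta> * gen X12 * gen X22,
     gen X21 * gen X12 - scalar (\<beta> * inverse \<alpha>) * gen X12 * gen X21,
     gen X22 * gen X11 - gen X11 * gen X22 - scalar (\<beta> - inverse \<alpha>) * gen X12 * gen X21}"

definition M2_ideal :: "'k::field \<Rightarrow> 'k \<Rightarrow> (mat_gen, 'k) free_alg set" where
  "M2_ideal \<alpha> \<beta> = Idl\<^bsub>ring_of_type_algebra\<^esub> (M2_relators \<alpha> \<beta>)"

definition M2 :: "'k::field \<Rightarrow> 'k \<Rightarrow> (mat_gen, 'k) free_alg set ring" where
  "M2 \<alpha> \<beta> = ring_of_type_algebra Quot M2_ideal \<alpha> \<beta>"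

definition M2_class :: "'k::field \<Rightarrow> 'k \<Rightarrow> (mat_gen, 'k) free_alg \<Rightarrow> (mat_gen, 'k) free_alg set" where
  "M2_class \<alpha> \<beta> p = M2_ideal \<alpha> \<beta> +>\<^bsub>ring_of_type_algebra\<^esub> p"


section \<open>The module \<open>\<V>\<^sub>3\<close>\<close>

text \<open>
  Vectors are coordinate functions on pairs \<open>(a, b)\<close> that vanish outside the index set. Since modules
  are right modules, a word acts letter by letter from left to right, hence \<^const>\<open>fold\<close>.
\<close>

type_synonym 'k vec = "nat \<times> nat \<Rightarrow> 'k"

definition scale :: "'k::field \<Rightarrow> 'k vec \<Rightarrow> 'k vec" where
  "scale c x = (\<lambda>p. c * x p)"

definition basis_vec :: "nat \<Rightarrow> nat \<Rightarrow> 'k::field vec" where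
  "basis_vec a b = (\<lambda>p. if p = (a, b) then 1 else 0)"

definition cyc_add :: "nat \<Rightarrow> nat \<Rightarrow> int \<Rightarrow> nat" where
  "cyc_add l b k = nat ((int b + k) mod int l)"

definition V3_index :: "'k::field \<Rightarrow> 'k \<Rightarrow> (nat \<times> nat) set" where
  "V3_index \<alpha> \<beta> = {0..unit_ord (\<alpha> * \<beta>) - 1} \<times> {0..unit_ord (\<alpha> * inverse \<beta>) - 1}"

fun V3_gen :: "'k::field \<Rightarrow> 'k \<Rightarrow> 'k \<Rightarrow> 'k \<Rightarrow> mat_gen \<Rightarrow> nat \<Rightarrow> nat \<Rightarrow> 'k vec" where
  "V3_gen \<alpha> \<beta> \<mu>1 \<mu>2 X11 a b =
    (if a \<noteq> 0
     then scale (\<mu>2 * inverse \<alpha> * (inverse \<alpha> * \<beta>) ^ b * ((\<alpha> * \<beta>) ^ a - 1)) (basis_vec (a - 1) b)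
     else (\<lambda>_. 0))"
| "V3_gen \<alpha> \<beta> \<mu>1 \<mu>2 X12 a b =
    scale (inverse \<mu>1 * \<mu>2 * \<beta> ^ a * (inverse \<alpha> * \<beta>) ^ b)
      (basis_vec a (cyc_add (unit_ord (\<alpha> * inverse \<beta>)) b (- 1)))"
| "V3_gen \<alpha> \<beta> \<mu>1 \<mu>2 X21 a b =
    scale (\<mu>1 * \<alpha> ^ a) (basis_vec a (cyc_add (unit_ord (\<alpha> * inverse \<beta>)) b 1))"
| "V3_gen \<alpha> \<beta> \<mu>1 \<mu>2 X22 a b =
    (if a \<noteq> unit_ord (\<alpha> * \<beta>) - 1 then basis_vec (a + 1) b else (\<lambda>_. 0))"

definition V3_op :: "'k::field \<Rightarrow> 'k \<Rightarrow> 'k \<Rightarrow> 'k \<Rightarrow> mat_gen \<Rightarrow> 'k vec \<Rightarrow> 'k vec" where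
  "V3_op \<alpha> \<beta> \<mu>1 \<mu>2 g x =
    (\<lambda>p. \<Sum>(a, b)\<in>V3_index \<alpha> \<beta>. x (a, b) * V3_gen \<alpha> \<beta> \<mu>1 \<mu>2 g a b p)"

definition V3_free_act ::
    "'k::field \<Rightarrow> 'k \<Rightarrow> 'k \<Rightarrow> 'k \<Rightarrow> (mat_gen, 'k) free_alg \<Rightarrow> 'k vec \<Rightarrow> 'k vec" where
  "V3_free_act \<alpha> \<beta> \<mu>1 \<mu>2 r x =
    (\<lambda>p. \<Sum>w\<in>Poly_Mapping.keys r. Poly_Mapping.lookup r w * fold (V3_op \<alpha> \<beta> \<mu>1 \<mu>2) (letters w) x p)"

text \<open>
  The action of a coset is the common value of the actions of its representatives; it is shown
  below that all representatives do act in the same way. The cosets of scalars act by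
  \<^const>\<open>scale\<close>, so homomorphisms over \<open>M2 \<alpha> \<beta>\<close> are automatically linear over the field.
\<close>

definition V3 :: "'k::field \<Rightarrow> 'k \<Rightarrow> 'k \<Rightarrow> 'k \<Rightarrow> ((mat_gen, 'k) free_alg set, 'k vec) module" where
  "V3 \<alpha> \<beta> \<mu>1 \<mu>2 =
    \<lparr>carrier = {x. \<forall>p. p \<notin> V3_index \<alpha> \<beta> \<longrightarrow> x p = 0},
     monoid.mult = undefined, one = undefined,
     ring.zero = (\<lambda>_. 0), add = (\<lambda>x y p. x p + y p),
     module.smult = (\<lambda>c x. the_elem ((\<lambda>r. V3_free_act \<alpha> \<beta> \<mu>1 \<mu>2 r x) ` c))\<rparr>"


section \<open>The action on \<open>\<V>\<^sub>3\<close> is well defined\<close>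

lemma free_alg_ring: "ring (ring_of_type_algebra :: ('g, 'k::field) free_alg ring)"
proof -
  have "\<exists>y. x + y = 0" for x :: "('g, 'k) free_alg"
    using add.right_inverse by blast
  thus ?thesis
    unfolding ring_of_type_algebra_def
    using add.right_inverse by unfold_locales (auto simp: algebra_simps Units_def)
qed

lemma M2_ideal: "ideal (M2_ideal \<alpha> \<beta>) ring_of_type_algebra"
  unfolding M2_ideal_def
  by (rule ring.genideal_ideal[OF free_alg_ring]) (simp add: ring_of_type_algebra_def)

lemma M2_ring: "ring (M2 \<alpha> \<beta>)"
  unfolding M2_def by (rule ideal.quotient_is_ring[OF M2_ideal])

lemma group_mult_of_field: "group (Multiplicative_Group.mult_of (ring_of_type_algebra :: 'k::field ring))"
  by (rule field.field_mult_group) (rule field_from_type_algebra)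

lemma unit_ord_dvd_iff:
  fixes \<xi> :: "'k::field"
  assumes "\<xi> \<noteq> 0"
  shows "\<xi> ^ n = 1 \<longleftrightarrow> unit_ord \<xi> dvd n"
proof -
  let ?G = "Multiplicative_Group.mult_of (ring_of_type_algebra :: 'k ring)"
  interpret group ?G by (rule group_mult_of_field)
  have "\<xi> [^]\<^bsub>?G\<^esub> m = \<xi> ^ m" for m :: nat
    by (induction m) (simp_all add: ring_of_type_algebra_def nat_pow_def)
  moreover have "\<xi> \<in> carrier ?G"
    using assms by (simp add: ring_of_type_algebra_def)
  ultimately show ?thesis
    using pow_eq_id[of \<xi> n] unfolding unit_ord_def by (simp add: ring_of_type_algebra_def)
qed


lemma free_alg_induct [case_names single add]:
  fixes r :: "'a \<Rightarrow>\<^sub>0 'b::comm_monoid_add"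
  assumes "\<And>w c. P (Poly_Mapping.single w c)"
    and "\<And>r s. P r \<Longrightarrow> P s \<Longrightarrow> P (r + s)"
  shows "P r"
proof -
  have *: "P (\<Sum>w\<in>S. Poly_Mapping.single w (f w))" if "finite S" for S and f :: "'a \<Rightarrow> 'b"
    using that
  proof induction
    case empty
    show ?case using assms(1)[of undefined 0] by simp
  qed (simp add: assms)
  have "r = (\<Sum>w\<in>Poly_Mapping.keys r. Poly_Mapping.single w (Poly_Mapping.lookup r w))"
    by (rule poly_mapping_eqI)
       (auto simp: lookup_sum lookup_single when_def in_keys_iff sum.delta)
  thus ?thesis using *[OF finite_keys, of "Poly_Mapping.lookup r" r] by metis
qed

context
  fixes \<alpha> \<beta> \<mu>1 \<mu>2 :: "'k::field"
begin

private abbreviation (input) "opr \<equiv> V3_op \<alpha> \<beta> \<mu>1 \<mu>2"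
private abbreviation (input) "act \<equiv> V3_free_act \<alpha> \<beta> \<mu>1 \<mu>2"

lemma finite_V3_index: "finite (V3_index \<alpha> \<beta>)"
  by (simp add: V3_index_def)

lemma V3_op_add: "opr g (\<lambda>p. x p + y p) = (\<lambda>p. opr g x p + opr g y p)"
  by (auto simp: V3_op_def sum.distrib[symmetric] algebra_simps intro!: ext sum.cong)

lemma V3_op_scale: "opr g (scale c x) = scale c (opr g x)"
  by (auto simp: V3_op_def scale_def sum_distrib_left algebra_simps intro!: ext sum.cong)

lemma fold_V3_op_add:
  "fold opr ws (\<lambda>p. x p + y p) = (\<lambda>p. fold opr ws x p + fold opr ws y p)"
  by (induction ws arbitrary: x y) (simp_all add: V3_op_add)

lemma fold_V3_op_scale: "fold opr ws (scale c x) = scale c (fold opr ws x)"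
  by (induction ws arbitrary: x) (simp_all add: V3_op_scale)

lemma V3_free_act_single: "act (Poly_Mapping.single w c) x = scale c (fold opr (letters w) x)"
  by (cases "c = 0") (auto simp: V3_free_act_def scale_def)

lemma V3_free_act_add_ring: "act (r + s) x = (\<lambda>p. act r x p + act s x p)"
  unfolding V3_free_act_def
  by (rule ext, rule setsum_keys_plus_distrib) (simp_all add: algebra_simps)

lemma V3_free_act_add: "act r (\<lambda>p. x p + y p) = (\<lambda>p. act r x p + act r y p)"
  unfolding V3_free_act_def fold_V3_op_add by (simp add: algebra_simps sum.distrib)

lemma V3_free_act_scale: "act r (scale c x) = scale c (act r x)"
  unfolding V3_free_act_def fold_V3_op_scale
  by (simp add: scale_def sum_distrib_left algebra_simps)

lemma V3_free_act_mult: "act (r * s) x = act s (act r x)"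
proof (induction r rule: free_alg_induct)
  case (single w c)
  show ?case
  proof (induction s rule: free_alg_induct)
    case (single v d)
    show ?case
      by (simp add: mult_single V3_free_act_single fold_V3_op_scale plus_word_def)
         (simp add: scale_def mult_ac)
  next
    case (add s t)
    thus ?case by (simp add: distrib_left V3_free_act_add_ring)
  qed
next
  case (add r t)
  thus ?case by (simp add: distrib_right V3_free_act_add_ring V3_free_act_add)
qed

lemma V3_free_act_minus: "act (r - s) x = (\<lambda>p. act r x p - act s x p)"
proof -
  have "act r x = act ((r - s) + s) x" by simp
  also have "\<dots> = (\<lambda>p. act (r - s) x p + act s x p)" by (rule V3_free_act_add_ring)
  finally show ?thesis by simp
qed

lemma V3_free_act_zero: "act 0 x = (\<lambda>_. 0)"
  by (simp add: V3_free_act_def)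

lemma V3_free_act_vec_zero: "act r (\<lambda>_. 0) = (\<lambda>_. 0)"
  using V3_free_act_scale[of r 0 "\<lambda>_. 0"] by (simp add: scale_def)

lemma V3_free_act_gen: "act (gen g) x = opr g x"
  by (simp add: gen_def V3_free_act_single scale_def)

lemma V3_free_act_scalar: "act (scalar c) x = scale c x"
  by (simp add: scalar_def V3_free_act_single zero_word_def)

lemma V3_free_act_one: "act 1 x = x"
  using V3_free_act_scalar[of 1 x] by (simp add: scalar_def scale_def)

lemma V3_op_basis:
  assumes "(a, b) \<in> V3_index \<alpha> \<beta>"
  shows "opr g (basis_vec a b) = V3_gen \<alpha> \<beta> \<mu>1 \<mu>2 g a b"
proof
  fix p
  have "opr g (basis_vec a b) p =
      (\<Sum>q\<in>V3_index \<alpha> \<beta>. if q = (a, b) then V3_gen \<alpha> \<beta> \<mu>1 \<mu>2 g a b p else 0)"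
    unfolding V3_op_def basis_vec_def by (intro sum.cong refl) (simp split: prod.splits)
  thus "opr g (basis_vec a b) p = V3_gen \<alpha> \<beta> \<mu>1 \<mu>2 g a b p"
    using assms by (simp add: finite_V3_index)
qed

lemma V3_vec_decomp:
  assumes "x \<in> carrier (V3 \<alpha> \<beta> \<mu>1 \<mu>2)"
  shows "x = (\<lambda>p. \<Sum>(a, b)\<in>V3_index \<alpha> \<beta>. scale (x (a, b)) (basis_vec a b) p)"
proof
  fix p
  have "(\<Sum>(a, b)\<in>V3_index \<alpha> \<beta>. scale (x (a, b)) (basis_vec a b) p) =
      (\<Sum>q\<in>V3_index \<alpha> \<beta>. if q = p then x p else 0)"
    by (rule sum.cong) (auto simp: scale_def basis_vec_def)
  thus "x p = (\<Sum>(a, b)\<in>V3_index \<alpha> \<beta>. scale (x (a, b)) (basis_vec a b) p)"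
    using assms unfolding V3_def
    by (cases "p \<in> V3_index \<alpha> \<beta>") (simp_all add: finite_V3_index del: split_paired_All)
qed

lemma V3_free_act_sum:
  assumes "finite I"
  shows "act r (\<lambda>p. \<Sum>i\<in>I. u i p) = (\<lambda>p. \<Sum>i\<in>I. act r (u i) p)"
  using assms by induction (simp_all add: V3_free_act_vec_zero V3_free_act_add)

lemma V3_free_act_eq_zeroI:
  assumes "\<And>a b. (a, b) \<in> V3_index \<alpha> \<beta> \<Longrightarrow> act r (basis_vec a b) = (\<lambda>_. 0)"
    and "x \<in> carrier (V3 \<alpha> \<beta> \<mu>1 \<mu>2)"
  shows "act r x = (\<lambda>_. 0)"
proof -
  have "act r x = act r (\<lambda>p. \<Sum>q\<in>V3_index \<alpha> \<beta>. scale (x q) (basis_vec (fst q) (snd q)) p)"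
    using V3_vec_decomp[OF assms(2)] by (simp add: case_prod_unfold)
  also have "\<dots> = (\<lambda>p. \<Sum>q\<in>V3_index \<alpha> \<beta>. scale (x q) (act r (basis_vec (fst q) (snd q))) p)"
    by (simp add: V3_free_act_sum finite_V3_index V3_free_act_scale)
  also have "\<dots> = (\<lambda>_. 0)"
    using assms(1) by (auto simp: scale_def intro!: ext sum.neutral)
  finally show ?thesis .
qed

context
  assumes nonzero: "\<alpha> \<noteq> 0" "\<beta> \<noteq> 0" "\<mu>1 \<noteq> 0"
    and ord_pos: "unit_ord (\<alpha> * \<beta>) > 0" "unit_ord (\<alpha> * inverse \<beta>) > 0"
begin

private abbreviation (input) "l1 \<equiv> unit_ord (\<alpha> * \<beta>)"
private abbreviation (input) "l2 \<equiv> unit_ord (\<alpha> * inverse \<beta>)"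

lemma cyc_add_less: "cyc_add l2 b k < l2"
  using ord_pos(2) by (simp add: cyc_add_def nat_less_iff)

lemma cyc_add_inverse:
  assumes "b < l2"
  shows "cyc_add l2 (cyc_add l2 b k) (- k) = b"
proof -
  have "(((int b + k) mod int l2) - k) mod int l2 = int b"
    using assms by (simp add: mod_simps)
  thus ?thesis using ord_pos(2) by (simp add: cyc_add_def)
qed

lemma power_cyc_add:
  "(inverse \<alpha> * \<beta>) ^ cyc_add l2 b 1 = (inverse \<alpha> * \<beta>) ^ Suc b"
proof -
  let ?q = "inverse \<alpha> * \<beta>"
  have "?q ^ l2 = inverse ((\<alpha> * inverse \<beta>) ^ l2)"
    by (simp add: power_mult_distrib power_inverse)
  also have "(\<alpha> * inverse \<beta>) ^ l2 = 1"
    using nonzero by (subst unit_ord_dvd_iff) simp_all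
  finally have q: "?q ^ l2 = 1" by simp
  have "cyc_add l2 b 1 = Suc b mod l2"
    unfolding cyc_add_def by (metis int_plus of_nat_1 nat_int of_nat_mod Suc_eq_plus1)
  moreover have "?q ^ (Suc b mod l2) = ?q ^ Suc b"
  proof -
    have "?q ^ Suc b = ?q ^ (l2 * (Suc b div l2) + Suc b mod l2)" by simp
    also have "\<dots> = ?q ^ (Suc b mod l2)"
      unfolding power_add power_mult q by simp
    finally show ?thesis by simp
  qed
  ultimately show ?thesis by simp
qed

lemma V3_index_iff: "(a, b) \<in> V3_index \<alpha> \<beta> \<longleftrightarrow> a < l1 \<and> b < l2"
  using ord_pos by (auto simp: V3_index_def)

lemma V3_gen_in_carrier:
  assumes "(a, b) \<in> V3_index \<alpha> \<beta>"
  shows "V3_gen \<alpha> \<beta> \<mu>1 \<mu>2 g a b \<in> carrier (V3 \<alpha> \<beta> \<mu>1 \<mu>2)"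
  using assms
  by (cases g) (auto simp: V3_def scale_def basis_vec_def V3_index_iff cyc_add_less)

lemma V3_op_in_carrier: "opr g x \<in> carrier (V3 \<alpha> \<beta> \<mu>1 \<mu>2)"
  using V3_gen_in_carrier by (auto simp: V3_op_def V3_def intro!: sum.neutral)

lemma V3_free_act_in_carrier:
  assumes "x \<in> carrier (V3 \<alpha> \<beta> \<mu>1 \<mu>2)"
  shows "act r x \<in> carrier (V3 \<alpha> \<beta> \<mu>1 \<mu>2)"
proof (induction r rule: free_alg_induct)
  case (single w c)
  have "fold opr ws x \<in> carrier (V3 \<alpha> \<beta> \<mu>1 \<mu>2)" for ws
    using assms by (induction ws arbitrary: x) (simp_all add: V3_op_in_carrier)
  from this[of "letters w"] show ?case by (simp add: V3_free_act_single V3_def scale_def)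
next
  case (add r s)
  thus ?case by (simp add: V3_free_act_add_ring V3_def)
qed

lemma V3_op_zero: "opr g (\<lambda>_. 0) = (\<lambda>_. 0)"
  by (simp add: V3_op_def)

lemma V3_relators_act:
  assumes "r \<in> M2_relators \<alpha> \<beta>" and ab: "(a, b) \<in> V3_index \<alpha> \<beta>"
  shows "act r (basis_vec a b) = (\<lambda>_. 0)"
proof -
  note [simp] = V3_free_act_minus V3_free_act_mult V3_free_act_gen V3_free_act_scalar
    V3_op_basis V3_op_scale V3_op_zero V3_index_iff cyc_add_less power_cyc_add
  have b: "b < l2" and a: "a < l1" using ab by (simp_all add: V3_index_iff)
  define c where "c = cyc_add l2 b (- 1)"
  have c: "c < l2" by (simp add: c_def)
  have cb: "cyc_add l2 c 1 = b" using cyc_add_inverse[OF b, of "-1"] by (simp add: c_def)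
  have bc: "cyc_add l2 (cyc_add l2 b 1) (- 1) = b" using cyc_add_inverse[OF b, of 1] by simp
  have pb: "(inverse \<alpha> * \<beta>) ^ b = (inverse \<alpha> * \<beta>) ^ Suc c"
    using power_cyc_add[of c] cb by simp
  have l1: "(\<alpha> * \<beta>) ^ l1 = 1"
    using nonzero by (subst unit_ord_dvd_iff) simp_all
  have top: "(\<alpha> * \<beta>) * (\<alpha> * \<beta>) ^ (l1 - Suc 0) = 1"
    using l1 ord_pos(1) by (metis Suc_diff_1 One_nat_def power_Suc)
  have pa: "\<alpha> ^ a = \<alpha> * \<alpha> ^ (a - Suc 0)" "\<beta> ^ a = \<beta> * \<beta> ^ (a - Suc 0)" if "a > 0"
    using that by (metis Suc_diff_1 One_nat_def power_Suc)+
  consider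
      "r = gen X12 * gen X11 - scalar \<alpha> * gen X11 * gen X12"
    | "r = gen X22 * gen X21 - scalar \<alpha> * gen X21 * gen X22"
    | "r = gen X21 * gen X11 - scalar \<beta> * gen X11 * gen X21"
    | "r = gen X22 * gen X12 - scalar \<beta> * gen X12 * gen X22"
    | "r = gen X21 * gen X12 - scalar (\<beta> * inverse \<alpha>) * gen X12 * gen X21"
    | "r = gen X22 * gen X11 - gen X11 * gen X22 - scalar (\<beta> - inverse \<alpha>) * gen X12 * gen X21"
    using assms(1) unfolding M2_relators_def by blast
  thus ?thesis
  proof cases
    case 1
    show ?thesis
      using a b c nonzero unfolding 1
      by (cases "a = 0"; simp add: c_def[symmetric] pb pa; simp add: scale_def fun_eq_iff field_simps)
  next
    case 2
    show ?thesis
      using a b c nonzero unfolding 2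
      by (cases "a = l1 - Suc 0"; simp; simp add: scale_def fun_eq_iff field_simps)
  next
    case 3
    show ?thesis
      using a b c nonzero unfolding 3
      by (cases "a = 0"; simp add: pa; simp add: scale_def fun_eq_iff field_simps)
  next
    case 4
    show ?thesis
      using a b c nonzero unfolding 4
      by (cases "a = l1 - Suc 0"; simp add: c_def[symmetric];
          simp add: scale_def fun_eq_iff field_simps)
  next
    case 5
    show ?thesis
      using a b c nonzero unfolding 5
      by (simp add: c_def[symmetric] cb bc pb; simp add: scale_def fun_eq_iff field_simps)
  next
    case 6
    let ?q = "(inverse \<alpha> * \<beta>) ^ b"
    have A: "opr X11 (opr X22 (basis_vec a b)) =
        scale (\<mu>2 * inverse \<alpha> * ?q * ((\<alpha> * \<beta>) * (\<alpha> * \<beta>) ^ a - 1)) (basis_vec a b)"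
      using a b top by (cases "a = l1 - Suc 0") (simp_all add: scale_def)
    have B: "opr X22 (opr X11 (basis_vec a b)) =
        scale (\<mu>2 * inverse \<alpha> * ?q * ((\<alpha> * \<beta>) ^ a - 1)) (basis_vec a b)"
    proof (cases "a = 0")
      case False
      hence "a - Suc 0 \<noteq> l1 - Suc 0" "a - Suc 0 < l1" "Suc (a - Suc 0) = a" using a by auto
      thus ?thesis using a b False by simp
    qed (use a b in \<open>simp add: scale_def\<close>)
    have C: "opr X21 (opr X12 (basis_vec a b)) =
        scale (\<mu>2 * (\<alpha> * \<beta>) ^ a * ?q) (basis_vec a b)"
      using a b c nonzero
      by (simp add: c_def[symmetric] cb power_mult_distrib; simp add: scale_def fun_eq_iff field_simps)
    show ?thesis
      using nonzero(1) unfolding 6 V3_free_act_minus V3_free_act_mult V3_free_act_gen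
        V3_free_act_scalar V3_op_scale A B C
      by (simp add: scale_def fun_eq_iff field_simps)
  qed
qed

lemma M2_ideal_act:
  assumes "r \<in> M2_ideal \<alpha> \<beta>" and "x \<in> carrier (V3 \<alpha> \<beta> \<mu>1 \<mu>2)"
  shows "act r x = (\<lambda>_. 0)"
proof -
  define J where "J = {r. \<forall>x\<in>carrier (V3 \<alpha> \<beta> \<mu>1 \<mu>2). act r x = (\<lambda>_. 0)}"
  have "ideal J ring_of_type_algebra"
  proof (rule idealI[OF free_alg_ring])
    interpret F: ring "ring_of_type_algebra :: (mat_gen, 'k) free_alg ring"
      by (rule free_alg_ring)
    have minus: "\<ominus>\<^bsub>ring_of_type_algebra\<^esub> r = - r" for r :: "(mat_gen, 'k) free_alg"
      by (rule F.minus_equality) (simp_all add: ring_of_type_algebra_def)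
    show "subgroup J (add_monoid ring_of_type_algebra)"
    proof (rule F.add.subgroupI)
      show "J \<noteq> {}" using V3_free_act_zero by (auto simp: J_def)
      fix r assume "r \<in> J"
      thus "\<ominus>\<^bsub>ring_of_type_algebra\<^esub> r \<in> J"
        using V3_free_act_minus[of 0 r] unfolding minus by (simp add: J_def V3_free_act_zero)
    qed (auto simp: J_def ring_of_type_algebra_def V3_free_act_add_ring)
  qed (auto simp: J_def ring_of_type_algebra_def V3_free_act_mult V3_free_act_vec_zero
         V3_free_act_in_carrier)
  moreover have "M2_relators \<alpha> \<beta> \<subseteq> J"
    unfolding J_def using V3_free_act_eq_zeroI V3_relators_act by blast
  ultimately have "M2_ideal \<alpha> \<beta> \<subseteq> J"
    unfolding M2_ideal_def by (rule ring.genideal_minimal[OF free_alg_ring])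
  thus ?thesis using assms by (auto simp: J_def)
qed

lemma V3_act_class:
  assumes "x \<in> carrier (V3 \<alpha> \<beta> \<mu>1 \<mu>2)"
  shows "M2_class \<alpha> \<beta> r \<odot>\<^bsub>V3 \<alpha> \<beta> \<mu>1 \<mu>2\<^esub> x = act r x"
proof -
  have *: "M2_class \<alpha> \<beta> r = (\<lambda>h. h + r) ` M2_ideal \<alpha> \<beta>"
    by (auto simp: M2_class_def a_r_coset_def r_coset_def ring_of_type_algebra_def)
  have "(\<lambda>s. act s x) ` M2_class \<alpha> \<beta> r = (\<lambda>h. act r x) ` M2_ideal \<alpha> \<beta>"
    unfolding * image_image
    by (rule image_cong) (simp_all add: V3_free_act_add_ring M2_ideal_act assms)
  also have "\<dots> = {act r x}"
    using additive_subgroup.zero_closed[OF ideal.axioms(1)[OF M2_ideal, of \<alpha> \<beta>]] by auto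
  finally show ?thesis by (simp add: V3_def)
qed

theorem V3_gen_action:
  assumes "a < l1" and "b < l2"
  shows "M2_class \<alpha> \<beta> (gen g) \<odot>\<^bsub>V3 \<alpha> \<beta> \<mu>1 \<mu>2\<^esub> basis_vec a b = V3_gen \<alpha> \<beta> \<mu>1 \<mu>2 g a b"
proof -
  have ab: "(a, b) \<in> V3_index \<alpha> \<beta>" using assms by (simp add: V3_index_iff)
  hence "basis_vec a b \<in> carrier (V3 \<alpha> \<beta> \<mu>1 \<mu>2)" by (auto simp: V3_def basis_vec_def)
  thus ?thesis using ab by (simp add: V3_act_class V3_free_act_gen V3_op_basis)
qed

theorem V3_scalar_action:
  assumes "x \<in> carrier (V3 \<alpha> \<beta> \<mu>1 \<mu>2)"
  shows "M2_class \<alpha> \<beta> (scalar c) \<odot>\<^bsub>V3 \<alpha> \<beta> \<mu>1 \<mu>2\<^esub> x = scale c x"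
  by (simp add: V3_act_class assms V3_free_act_scalar)

theorem V3_right_module: "right_module (M2 \<alpha> \<beta>) (V3 \<alpha> \<beta> \<mu>1 \<mu>2)"
proof -
  let ?F = "ring_of_type_algebra :: (mat_gen, 'k) free_alg ring"
  let ?V = "V3 \<alpha> \<beta> \<mu>1 \<mu>2"
  interpret I: ideal "M2_ideal \<alpha> \<beta>" ?F by (rule M2_ideal)
  have carr: "carrier ?F = UNIV" by (simp add: ring_of_type_algebra_def)
  have M2_carrier: "r \<in> carrier (M2 \<alpha> \<beta>) \<longleftrightarrow> (\<exists>s. r = M2_class \<alpha> \<beta> s)" for r
    by (auto simp: M2_def FactRing_def A_RCOSETS_def' M2_class_def a_r_coset_def' carr
          r_coset_def RCOSETS_def A_RCOSETS_def a_r_coset_def ring_of_type_algebra_def)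
  have M2_add: "M2_class \<alpha> \<beta> r \<oplus>\<^bsub>M2 \<alpha> \<beta>\<^esub> M2_class \<alpha> \<beta> s = M2_class \<alpha> \<beta> (r + s)" for r s
    using I.a_rcos_sum[of r s] by (simp add: M2_def FactRing_def M2_class_def ring_of_type_algebra_def)
  have M2_mult: "M2_class \<alpha> \<beta> r \<otimes>\<^bsub>M2 \<alpha> \<beta>\<^esub> M2_class \<alpha> \<beta> s = M2_class \<alpha> \<beta> (r * s)" for r s
    using I.rcoset_mult_add[of r s] by (simp add: M2_def FactRing_def M2_class_def ring_of_type_algebra_def)
  have M2_one: "\<one>\<^bsub>M2 \<alpha> \<beta>\<^esub> = M2_class \<alpha> \<beta> 1"
    by (simp add: M2_def FactRing_def M2_class_def ring_of_type_algebra_def)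
  have group: "abelian_group ?V"
  proof (rule abelian_groupI)
    fix x assume "x \<in> carrier ?V"
    thus "\<exists>y\<in>carrier ?V. y \<oplus>\<^bsub>?V\<^esub> x = \<zero>\<^bsub>?V\<^esub>"
      by (intro bexI[of _ "\<lambda>p. - x p"]) (auto simp: V3_def)
  qed (auto simp: V3_def algebra_simps)
  have V_add: "x \<oplus>\<^bsub>?V\<^esub> y = (\<lambda>p. x p + y p)" for x y by (simp add: V3_def)
  have V_closed: "(\<lambda>p. x p + y p) \<in> carrier ?V" if "x \<in> carrier ?V" "y \<in> carrier ?V" for x y
    using that by (simp add: V3_def)
  show ?thesis
    by (intro right_module.intro M2_ring group right_module_axioms.intro)
       (auto simp: M2_carrier M2_add M2_mult M2_one V_add V_closed V3_act_class
          V3_free_act_in_carrier V3_free_act_add_ring V3_free_act_add V3_free_act_mult V3_free_act_one)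
qed

end

end

end

theory Submission
  imports Defs
begin

text \<open>
  The vectors killed by \<open>X11\<close> form the span of the \<open>e(0, b)\<close>. There \<open>X12 X21\<close> acts diagonally with
  eigenvalues \<open>\<mu>2 (\<beta>/\<alpha>)\<^sup>b\<close> and the \<open>l2\<close>-th power of \<open>X21\<close> acts as the scalar \<open>\<mu>1 ^ l2\<close>, so an
  isomorphism forces the stated relations between the parameters. Conversely,
  \<open>e(a, b) \<mapsto> (lam1/\<mu>1)\<^sup>b e(a, b + v)\<close> intertwines the actions of the four generators.
\<close>

section \<open>Cyclic shifts and orders of roots of unity\<close>

lemma cyc_add_lt: "l > 0 \<Longrightarrow> cyc_add l b k < l"
  by (simp add: cyc_add_def nat_less_iff)

lemma cyc_add_cyc_add: "l > 0 \<Longrightarrow> cyc_add l (cyc_add l b j) k = cyc_add l b (j + k)"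
  by (simp add: cyc_add_def mod_simps add.assoc)

lemma cyc_add_mod: "b < l \<Longrightarrow> int l dvd k \<Longrightarrow> cyc_add l b k = b"
  by (auto simp: cyc_add_def)

text \<open>Shifts by \<open>k\<close> and \<open>- k\<close> undo each other on residues below
  \<open>l\<close>. Evaluating \<open>basis_vec\<close> at a shifted index produces the left-hand
  equation; solving it for \<open>b'\<close> isolates the one source index.\<close>

lemma cyc_add_eq_iff:
  assumes "b < l" "b' < l"
  shows "b = cyc_add l b' k \<longleftrightarrow> b' = cyc_add l b (- k)"
proof -
  have "cyc_add l (cyc_add l c k) (- k) = c" "cyc_add l (cyc_add l c (- k)) k = c" if "c < l" for c
    using that by (simp_all add: cyc_add_cyc_add cyc_add_mod)
  then show ?thesis using assms by metis
qed

text \<open>Exponents matter only modulo \<open>l\<close>, so wrap-around is invisible to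
  \<open>z\<close>. It serves both \<open>inverse \<alpha> * \<beta>\<close> and the quotient of the
  first parameters.\<close>

lemma power_cyc_add_of_nat:
  fixes z :: "'a::monoid_mult"
  assumes "z ^ l = 1"
  shows "z ^ cyc_add l b (int k) = z ^ (b + k)"
proof -
  have "cyc_add l b (int k) = (b + k) mod l"
    by (simp add: cyc_add_def nat_mod_distrib nat_add_distrib)
  moreover have "z ^ (b + k) = z ^ (l * ((b + k) div l) + (b + k) mod l)"
    by simp
  ultimately show ?thesis
    using assms by (simp only: power_add power_mult power_one mult_1_left)
qed

lemma unit_ord_pos:
  fixes \<xi> :: "'k::field"
  assumes "\<xi> \<noteq> 0" "\<xi> ^ n = 1" "n > 0"
  shows "unit_ord \<xi> > 0"
  using assms unit_ord_dvd_iff[of \<xi> n] by (metis dvd_0_left_iff gr0I)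

lemma M2_carrier_class: "r \<in> carrier (M2 \<alpha> \<beta>) \<longleftrightarrow> (\<exists>s. r = M2_class \<alpha> \<beta> s)"
  by (auto simp: M2_def FactRing_def A_RCOSETS_def' M2_class_def a_r_coset_def'
        r_coset_def RCOSETS_def A_RCOSETS_def a_r_coset_def ring_of_type_algebra_def)

text \<open>Coordinates are pulled back: the entry at \<open>b\<close> is read from
  \<open>b + k\<close> modulo \<open>l2\<close>, so basis vectors move by \<open>- k\<close>. The
  weight \<open>w\<close> is indexed by the target \<open>b\<close>.\<close>

definition weighted_shift ::
    "'k::field \<Rightarrow> 'k \<Rightarrow> int \<Rightarrow> (nat \<Rightarrow> 'k) \<Rightarrow> 'k vec \<Rightarrow> 'k vec" where
  "weighted_shift \<alpha> \<beta> k w x = (\<lambda>(a, b).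
    if (a, b) \<in> V3_index \<alpha> \<beta> then w b * x (a, cyc_add (unit_ord (\<alpha> * inverse \<beta>)) b k) else 0)"

lemma sum_eq_single:
  assumes "finite A" "p \<in> A" "\<And>q. q \<in> A \<Longrightarrow> q \<noteq> p \<Longrightarrow> g q = 0"
  shows "sum g A = g p"
  using sum.mono_neutral_right[of A "{p}" g] assms by auto

context
  fixes \<alpha> \<beta> :: "'k::field"
  assumes nz: "\<alpha> \<noteq> 0" "\<beta> \<noteq> 0"
    and ord_pos: "unit_ord (\<alpha> * \<beta>) > 0" "unit_ord (\<alpha> * inverse \<beta>) > 0"
begin

private abbreviation (input) "l1 \<equiv> unit_ord (\<alpha> * \<beta>)"
private abbreviation (input) "l2 \<equiv> unit_ord (\<alpha> * inverse \<beta>)"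
private abbreviation (input) "q \<equiv> inverse \<alpha> * \<beta>"

lemma mem_V3_index: "(a, b) \<in> V3_index \<alpha> \<beta> \<longleftrightarrow> a < l1 \<and> b < l2"
  using ord_pos by (auto simp: V3_index_def)

lemma power_q: "q ^ l2 = 1"
proof -
  have "q ^ l2 = inverse ((\<alpha> * inverse \<beta>) ^ l2)"
    by (simp add: power_mult_distrib power_inverse)
  also have "(\<alpha> * inverse \<beta>) ^ l2 = 1"
    using nz by (subst unit_ord_dvd_iff) simp_all
  finally show ?thesis by simp
qed

section \<open>Coordinates of the generators' action\<close>

text \<open>\<open>X11\<close> lowers the first index, so only \<open>e(a + 1, b)\<close>
  contributes; the top row has no such source.\<close>

lemma V3_op_X11_apply:
  assumes "a < l1" "b < l2"
  shows "V3_op \<alpha> \<beta> \<mu>1 \<mu>2 X11 x (a, b) =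
    (if Suc a < l1 then \<mu>2 * inverse \<alpha> * q ^ b * ((\<alpha> * \<beta>) ^ Suc a - 1) * x (Suc a, b) else 0)"
proof (cases "Suc a < l1")
  case True
  show ?thesis
    unfolding V3_op_def
    by (subst sum_eq_single[where p = "(Suc a, b)"])
       (use True assms in \<open>auto simp: finite_V3_index mem_V3_index scale_def basis_vec_def
         split: if_splits\<close>)
next
  case False
  then show ?thesis
    unfolding V3_op_def
    by (subst sum.neutral) (auto simp: mem_V3_index scale_def basis_vec_def)
qed

text \<open>The source index is \<open>b + 1\<close> modulo \<open>l2\<close>; since
  \<open>q ^ l2 = 1\<close>, its power of \<open>q\<close> may be written with exponent
  \<open>Suc b\<close> even at the wrap-around.\<close>

lemma V3_op_X12_apply:
  assumes "a < l1" "b < l2"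
  shows "V3_op \<alpha> \<beta> \<mu>1 \<mu>2 X12 x (a, b) =
    inverse \<mu>1 * \<mu>2 * \<beta> ^ a * q ^ Suc b * x (a, cyc_add l2 b 1)"
  unfolding V3_op_def
  by (subst sum_eq_single[where p = "(a, cyc_add l2 b 1)"])
     (use assms power_cyc_add_of_nat[OF power_q, of b 1] in
       \<open>auto simp: finite_V3_index mem_V3_index scale_def basis_vec_def cyc_add_lt ord_pos
         cyc_add_cyc_add cyc_add_mod cyc_add_eq_iff[of b _ _ "- 1"]
         split: if_splits\<close>)

lemma V3_op_X21_apply:
  assumes "a < l1" "b < l2"
  shows "V3_op \<alpha> \<beta> \<mu>1 \<mu>2 X21 x (a, b) = \<mu>1 * \<alpha> ^ a * x (a, cyc_add l2 b (- 1))"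
  unfolding V3_op_def
  by (subst sum_eq_single[where p = "(a, cyc_add l2 b (- 1))"])
     (use assms in
       \<open>auto simp: finite_V3_index mem_V3_index scale_def basis_vec_def cyc_add_lt ord_pos
         cyc_add_cyc_add cyc_add_mod cyc_add_eq_iff[of b _ _ 1]
         split: if_splits\<close>)

lemma V3_op_X22_apply:
  assumes "a < l1" "b < l2"
  shows "V3_op \<alpha> \<beta> \<mu>1 \<mu>2 X22 x (a, b) = (if a = 0 then 0 else x (a - 1, b))"
proof (cases "a = 0")
  case True
  then show ?thesis
    unfolding V3_op_def
    by (subst sum.neutral) (auto simp: mem_V3_index scale_def basis_vec_def)
next
  case False
  then show ?thesis
    unfolding V3_op_def
    by (subst sum_eq_single[where p = "(a - 1, b)"])
       (use assms in \<open>auto simp: finite_V3_index mem_V3_index basis_vec_def split: if_splits\<close>)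
qed

lemma V3_carrier_iff: "x \<in> carrier (V3 \<alpha> \<beta> \<mu>1 \<mu>2) \<longleftrightarrow> (\<forall>p. p \<notin> V3_index \<alpha> \<beta> \<longrightarrow> x p = 0)"
  by (simp add: V3_def)

lemma V3_op_carrier: "\<mu>1 \<noteq> 0 \<Longrightarrow> V3_op \<alpha> \<beta> \<mu>1 \<mu>2 g x \<in> carrier (V3 \<alpha> \<beta> \<mu>1 \<mu>2)"
  using V3_op_in_carrier[OF nz _ ord_pos] .

lemma V3_class_action:
  "\<mu>1 \<noteq> 0 \<Longrightarrow> x \<in> carrier (V3 \<alpha> \<beta> \<mu>1 \<mu>2) \<Longrightarrow>
    M2_class \<alpha> \<beta> r \<odot>\<^bsub>V3 \<alpha> \<beta> \<mu>1 \<mu>2\<^esub> x = V3_free_act \<alpha> \<beta> \<mu>1 \<mu>2 r x"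
  using V3_act_class[OF nz _ ord_pos] .

text \<open>In row 0 the factor \<open>\<alpha> ^ a\<close> is 1, so every application contributes
  just \<open>\<mu>1\<close> and one shift.\<close>

lemma V3_funpow_X21_apply:
  assumes "b < l2"
  shows "(V3_op \<alpha> \<beta> \<mu>1 \<mu>2 X21 ^^ n) x (0, b) = \<mu>1 ^ n * x (0, cyc_add l2 b (- int n))"
  using assms
proof (induction n arbitrary: b)
  case 0
  then show ?case by (simp add: cyc_add_mod)
next
  case (Suc n)
  then show ?case
    by (simp add: V3_op_X21_apply ord_pos cyc_add_lt cyc_add_cyc_add)
qed

text \<open>This is the right action of the product X12 X21: the two shifts cancel, as do
  \<open>\<mu>1\<close> and its inverse, leaving a diagonal operator on row 0.\<close>

lemma V3_op_X21_X12_apply: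
  assumes "b < l2" "\<mu>1 \<noteq> 0"
  shows "V3_op \<alpha> \<beta> \<mu>1 \<mu>2 X21 (V3_op \<alpha> \<beta> \<mu>1 \<mu>2 X12 x) (0, b) = \<mu>2 * q ^ b * x (0, b)"
proof -
  have "q ^ Suc (cyc_add l2 b (- 1)) = q ^ b"
    using power_cyc_add_of_nat[OF power_q, of "cyc_add l2 b (- 1)" 1] assms ord_pos
    by (simp add: cyc_add_cyc_add cyc_add_mod)
  then show ?thesis
    using assms ord_pos
    by (simp add: V3_op_X21_apply V3_op_X12_apply cyc_add_lt cyc_add_cyc_add cyc_add_mod
        del: power_Suc)
qed

section \<open>Invariants of the isomorphism class\<close>

text \<open>For \<open>0 < a < l1\<close> the coefficient of \<open>X11\<close> at
  \<open>e(a, b)\<close> is nonzero, because \<open>l1\<close> is the exact order of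
  \<open>\<alpha> * \<beta>\<close>.\<close>

lemma V3_op_X11_kernel:
  assumes "x \<in> carrier (V3 \<alpha> \<beta> \<mu>1 \<mu>2)" "\<mu>2 \<noteq> 0" "V3_op \<alpha> \<beta> \<mu>1 \<mu>2 X11 x = (\<lambda>_. 0)" "a > 0"
  shows "x (a, b) = 0"
proof (cases "a < l1 \<and> b < l2")
  case True
  obtain c where a: "a = Suc c" using \<open>a > 0\<close> by (cases a) auto
  have "(\<alpha> * \<beta>) ^ a \<noteq> 1"
    using True \<open>a > 0\<close> nz by (subst unit_ord_dvd_iff) (auto dest: dvd_imp_le)
  moreover have "V3_op \<alpha> \<beta> \<mu>1 \<mu>2 X11 x (c, b) = 0" using assms(3) by simp
  ultimately show ?thesis
    using True nz assms(2) unfolding a by (subst (asm) V3_op_X11_apply) auto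
qed (use assms(1) in \<open>auto simp: V3_carrier_iff mem_V3_index\<close>)

lemma V3_isomorphic_imp:
  assumes nonzero: "\<mu>1 \<noteq> 0" "\<mu>2 \<noteq> 0" "\<nu>1 \<noteq> 0" "\<nu>2 \<noteq> 0"
    and "right_module_isomorphic (M2 \<alpha> \<beta>) (V3 \<alpha> \<beta> \<mu>1 \<mu>2) (V3 \<alpha> \<beta> \<nu>1 \<nu>2)"
  shows "\<mu>1 ^ l2 = \<nu>1 ^ l2 \<and> (\<exists>v<l2. \<mu>2 = \<nu>2 * q ^ v)"
proof -
  let ?V = "V3 \<alpha> \<beta> \<mu>1 \<mu>2" and ?W = "V3 \<alpha> \<beta> \<nu>1 \<nu>2"
  let ?f = "V3_op \<alpha> \<beta> \<mu>1 \<mu>2" and ?g = "V3_op \<alpha> \<beta> \<nu>1 \<nu>2"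
  obtain h where h: "h \<in> right_module_hom (M2 \<alpha> \<beta>) ?V ?W" "bij_betw h (carrier ?V) (carrier ?W)"
    using assms unfolding right_module_isomorphic_def by auto
  have closed: "h x \<in> carrier ?W" if "x \<in> carrier ?V" for x
    using h that by (auto simp: right_module_hom_def)
  have act: "h (V3_free_act \<alpha> \<beta> \<mu>1 \<mu>2 r x) = V3_free_act \<alpha> \<beta> \<nu>1 \<nu>2 r (h x)"
    if "x \<in> carrier ?V" for r x
  proof -
    have "M2_class \<alpha> \<beta> r \<in> carrier (M2 \<alpha> \<beta>)" using M2_carrier_class by blast
    then have "h (M2_class \<alpha> \<beta> r \<odot>\<^bsub>?V\<^esub> x) = M2_class \<alpha> \<beta> r \<odot>\<^bsub>?W\<^esub> h x"
      using h(1) that by (simp add: right_module_hom_def)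
    then show ?thesis using that closed nonzero by (simp add: V3_class_action)
  qed
  have h_op: "h (?f g x) = ?g g (h x)" if "x \<in> carrier ?V" for g x
    using act[OF that, of "gen g"] by (simp add: V3_free_act_gen)
  \<comment> \<open>Linearity over the field comes from the cosets of scalars.\<close>
  have h_scale: "h (scale c x) = scale c (h x)" if "x \<in> carrier ?V" for c x
    using act[OF that, of "scalar c"] by (simp add: V3_free_act_scalar)
  have zero: "(\<lambda>_. 0) \<in> carrier ?V" by (simp add: V3_carrier_iff)
  have h_zero: "h (\<lambda>_. 0) = (\<lambda>_. 0)"
    using h_scale[OF zero, of 0] by (simp add: scale_def)
  have h_funpow: "h ((?f g ^^ n) x) = (?g g ^^ n) (h x)" if "x \<in> carrier ?V" for g n x
  proof (induction n)
    case (Suc n)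
    have "(?f g ^^ n) x \<in> carrier ?V"
      using that V3_op_carrier nonzero by (cases n) auto
    then show ?case using Suc h_op by simp
  qed simp
  \<comment> \<open>\<open>e(0, 0)\<close> is killed by \<open>X11\<close> and is an eigenvector of
    X12 X21 with eigenvalue \<open>\<mu>2 * q ^ 0 = \<mu>2\<close>; its image \<open>x\<close>
    inherits both properties.\<close>
  define e :: "'k vec" where "e = basis_vec 0 0"
  define x where "x = h e"
  have e: "e \<in> carrier ?V"
    using ord_pos by (auto simp: V3_carrier_iff e_def basis_vec_def mem_V3_index)
  have e_off: "e (a, b) = 0" if "(a, b) \<noteq> (0, 0)" for a b
    using that by (auto simp: e_def basis_vec_def)
  have W: "x \<in> carrier ?W" using closed e by (simp add: x_def)
  have eq_scale_e: "y = scale c e"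
    if "y \<in> carrier ?V" "\<And>a b. a < l1 \<Longrightarrow> b < l2 \<Longrightarrow> y (a, b) = c * e (a, b)" for y c
    using that e unfolding scale_def
    by (intro ext) (metis V3_carrier_iff mem_V3_index mult_zero_right surj_pair)
  have "?f X11 e = scale 0 e"
  proof (rule eq_scale_e)
    show "?f X11 e (a, b) = 0 * e (a, b)" if "a < l1" "b < l2" for a b
      using that by (simp add: V3_op_X11_apply e_off)
  qed (simp add: V3_op_carrier nonzero)
  then have "?g X11 x = (\<lambda>_. 0)"
    using h_op[OF e, of X11] h_scale[OF e, of 0] by (simp add: x_def scale_def)
  then have x_pos: "x (a, b) = 0" if "a > 0" for a b
    using V3_op_X11_kernel[OF W] that nonzero by blast
  \<comment> \<open>Injectivity keeps \<open>x\<close> nonzero, and \<open>x_pos\<close> confines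
    its support to row 0. The second index of a nonzero coordinate will be the required
    \<open>v\<close>.\<close>
  have "e \<noteq> (\<lambda>_. 0)" by (auto simp: e_def basis_vec_def fun_eq_iff)
  then have "x \<noteq> (\<lambda>_. 0)"
    using h(2) e zero h_zero unfolding x_def bij_betw_def by (metis inj_onD)
  then obtain b where b: "x (0, b) \<noteq> 0"
    using x_pos by (metis gr0I surj_pair)
  then have b_less: "b < l2" using W by (auto simp: V3_carrier_iff mem_V3_index)
  have eq_scale_eI: "y = scale c e"
    if "y \<in> carrier ?V" "\<And>b. b < l2 \<Longrightarrow> y (0, b) = c * e (0, b)"
      "\<And>a b. a < l1 \<Longrightarrow> b < l2 \<Longrightarrow> a > 0 \<Longrightarrow> y (a, b) = 0" for y c
  proof (rule eq_scale_e[OF that(1)])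
    fix a b assume "a < l1" "b < l2"
    then show "y (a, b) = c * e (a, b)"
      using that(2,3) e_off by (cases "a = 0") auto
  qed
  have "?f X21 (?f X12 e) = scale \<mu>2 e"
  proof (rule eq_scale_eI)
    show "?f X21 (?f X12 e) (0, b) = \<mu>2 * e (0, b)" if "b < l2" for b
      using that nonzero by (cases "b = 0") (simp_all add: V3_op_X21_X12_apply e_off)
  qed (use nonzero ord_pos in
      \<open>simp_all add: V3_op_carrier V3_op_X21_apply V3_op_X12_apply cyc_add_lt e_off\<close>)
  then have "?g X21 (?g X12 x) = scale \<mu>2 x"
    using h_op[OF e, of X12] h_op[OF V3_op_carrier, of X21 X12 e] h_scale[OF e, of \<mu>2] nonzero
    by (simp add: x_def)
  \<comment> \<open>The two eigenvalues are compared at the nonzero coordinate.\<close>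
  then have "\<mu>2 * x (0, b) = \<nu>2 * q ^ b * x (0, b)"
    using V3_op_X21_X12_apply[OF b_less \<open>\<nu>1 \<noteq> 0\<close>, of \<nu>2 x] by (simp add: scale_def)
  then have mu2: "\<mu>2 = \<nu>2 * q ^ b" using b by simp
  \<comment> \<open>\<open>X21\<close> preserves the first index, so rows above 0 stay
    empty.\<close>
  have top: "(?f X21 ^^ n) e (a, b) = 0" if "a < l1" "b < l2" "a > 0" for n a b
    using that by (induction n arbitrary: b) (simp_all add: V3_op_X21_apply cyc_add_lt e_off)
  \<comment> \<open>After \<open>l2\<close> steps the shift has gone once around the cycle, so only
    the scalar \<open>\<mu>1 ^ l2\<close> remains.\<close>
  have "(?f X21 ^^ l2) e = scale (\<mu>1 ^ l2) e"
  proof (rule eq_scale_eI)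
    show "(?f X21 ^^ l2) e \<in> carrier ?V"
      using ord_pos V3_op_carrier nonzero by (cases l2) auto
  qed (simp_all add: V3_funpow_X21_apply cyc_add_mod top)
  then have "(?g X21 ^^ l2) x = scale (\<mu>1 ^ l2) x"
    using h_funpow[OF e, of l2 X21] h_scale[OF e] by (simp add: x_def)
  moreover have "(?g X21 ^^ l2) x (0, b) = \<nu>1 ^ l2 * x (0, b)"
    using V3_funpow_X21_apply[OF b_less] b_less by (simp add: cyc_add_mod)
  ultimately have "\<mu>1 ^ l2 = \<nu>1 ^ l2"
    using b by (simp add: scale_def)
  then show ?thesis using b mu2 b_less by auto
qed

section \<open>Intertwining shifts\<close>

lemma weighted_shift_carrier: "weighted_shift \<alpha> \<beta> k w x \<in> carrier (V3 \<alpha> \<beta> \<mu>1 \<mu>2)"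
  by (auto simp: V3_carrier_iff weighted_shift_def)

lemma weighted_shift_apply:
  "a < l1 \<Longrightarrow> b < l2 \<Longrightarrow> weighted_shift \<alpha> \<beta> k w x (a, b) = w b * x (a, cyc_add l2 b k)"
  by (simp add: weighted_shift_def mem_V3_index)

lemma weighted_shift_add:
  "weighted_shift \<alpha> \<beta> k w (\<lambda>p. x p + y p) =
    (\<lambda>p. weighted_shift \<alpha> \<beta> k w x p + weighted_shift \<alpha> \<beta> k w y p)"
  by (auto simp: weighted_shift_def fun_eq_iff distrib_left)

lemma weighted_shift_scale:
  "weighted_shift \<alpha> \<beta> k w (scale c x) = scale c (weighted_shift \<alpha> \<beta> k w x)"
  by (auto simp: weighted_shift_def fun_eq_iff scale_def)

text \<open>The carrier depends only on \<open>\<alpha>\<close> and \<open>\<beta>\<close>, so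
  vectors from modules with different parameters can be compared coordinatewise.\<close>

lemma V3_vec_eqI:
  assumes "x \<in> carrier (V3 \<alpha> \<beta> \<mu>1 \<mu>2)" "y \<in> carrier (V3 \<alpha> \<beta> \<nu>1 \<nu>2)"
    and "\<And>a b. a < l1 \<Longrightarrow> b < l2 \<Longrightarrow> x (a, b) = y (a, b)"
  shows "x = y"
  using assms by (intro ext) (metis V3_carrier_iff mem_V3_index surj_pair)

lemma weighted_shift_inverse:
  assumes "x \<in> carrier (V3 \<alpha> \<beta> \<mu>1 \<mu>2)"
    and "\<And>b. b < l2 \<Longrightarrow> w b * w' (cyc_add l2 b k) = 1"
  shows "weighted_shift \<alpha> \<beta> k w (weighted_shift \<alpha> \<beta> (- k) w' x) = x"
proof (rule V3_vec_eqI[OF weighted_shift_carrier assms(1)])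
  fix a b assume ab: "a < l1" "b < l2"
  then show "weighted_shift \<alpha> \<beta> k w (weighted_shift \<alpha> \<beta> (- k) w' x) (a, b) = x (a, b)"
    using assms(2)[OF ab(2)] ord_pos
    by (simp add: weighted_shift_apply cyc_add_lt cyc_add_cyc_add cyc_add_mod flip: mult.assoc)
qed

text \<open>With \<open>t = \<nu>1 / \<mu>1\<close> this shift sends \<open>e(a, s)\<close> to
  \<open>t ^ s\<close> times \<open>e(a, s + v)\<close>. Compatibility with \<open>X21\<close>
  forces the weight to grow by \<open>t\<close> per step, which closes up around the cycle because
  \<open>t ^ l2 = 1\<close>; the relation between \<open>\<mu>2\<close> and \<open>\<nu>2\<close>
  absorbs the powers of \<open>q\<close> in \<open>X11\<close> and \<open>X12\<close>.\<close>

lemma weighted_shift_V3_op: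
  assumes nonzero: "\<mu>1 \<noteq> 0" "\<nu>1 \<noteq> 0"
    and mu1: "\<mu>1 ^ l2 = \<nu>1 ^ l2" and mu2: "\<mu>2 = \<nu>2 * q ^ v"
  defines "w \<equiv> \<lambda>b. (\<nu>1 / \<mu>1) ^ cyc_add l2 b (- int v)"
  shows "weighted_shift \<alpha> \<beta> (- int v) w (V3_op \<alpha> \<beta> \<mu>1 \<mu>2 g x) =
    V3_op \<alpha> \<beta> \<nu>1 \<nu>2 g (weighted_shift \<alpha> \<beta> (- int v) w x)"
proof (rule V3_vec_eqI[OF weighted_shift_carrier[of _ _ _ \<nu>1 \<nu>2] V3_op_carrier[OF \<open>\<nu>1 \<noteq> 0\<close>]])
  fix a b assume ab: "a < l1" "b < l2"
  \<comment> \<open>\<open>s\<close> is the source index of the coordinate \<open>b\<close>, and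
    also the exponent of the weight there.\<close>
  define s where "s = cyc_add l2 b (- int v)"
  have s: "s < l2" using ord_pos by (simp add: s_def cyc_add_lt)
  have shift: "cyc_add l2 (cyc_add l2 b k) (- int v) = cyc_add l2 s k" for k
    using ord_pos by (simp add: s_def cyc_add_cyc_add add.commute)
  have t: "(\<nu>1 / \<mu>1) ^ l2 = 1"
    using mu1 nonzero by (simp add: power_divide)
  have t1: "(\<nu>1 / \<mu>1) ^ cyc_add l2 s 1 = (\<nu>1 / \<mu>1) ^ s * (\<nu>1 / \<mu>1)"
    using power_cyc_add_of_nat[OF t, of s 1] by simp
  \<comment> \<open>Stepping up from the predecessor of \<open>s\<close> avoids a subtracted
    exponent and covers \<open>s = 0\<close>.\<close>
  have t2: "(\<nu>1 / \<mu>1) ^ s = (\<nu>1 / \<mu>1) ^ cyc_add l2 s (- 1) * (\<nu>1 / \<mu>1)"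
    using power_cyc_add_of_nat[OF t, of "cyc_add l2 s (- 1)" 1] s ord_pos
    by (simp add: cyc_add_cyc_add cyc_add_mod)
  have "q ^ b = q ^ (s + v)"
    using power_cyc_add_of_nat[OF power_q, of s v] ab ord_pos
    by (simp add: s_def cyc_add_cyc_add cyc_add_mod)
  then have mu2_q: "\<mu>2 * q ^ s = \<nu>2 * q ^ b"
    unfolding mu2 by (simp add: power_add)
  note [simp] = weighted_shift_apply V3_op_X11_apply V3_op_X12_apply V3_op_X21_apply
    V3_op_X22_apply cyc_add_lt ord_pos s shift
  show "weighted_shift \<alpha> \<beta> (- int v) w (V3_op \<alpha> \<beta> \<mu>1 \<mu>2 g x) (a, b) =
    V3_op \<alpha> \<beta> \<nu>1 \<nu>2 g (weighted_shift \<alpha> \<beta> (- int v) w x) (a, b)"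
  proof (cases g)
    case X11
    then show ?thesis
      using ab mu2_q by (simp add: w_def flip: s_def)
  next
    case X12
    \<comment> \<open>The factors are regrouped so that \<open>\<mu>2 * q ^ s\<close> appears as a
      block for \<open>mu2_q\<close>.\<close>
    have "(\<nu>1 / \<mu>1) ^ s * (inverse \<mu>1 * \<mu>2 * \<beta> ^ a * q ^ Suc s * y) =
        (\<mu>2 * q ^ s) * q * inverse \<mu>1 * \<beta> ^ a * (\<nu>1 / \<mu>1) ^ s * y" for y
      by (simp add: mult_ac)
    also have "\<dots> y = inverse \<nu>1 * \<nu>2 * \<beta> ^ a * q ^ Suc b * ((\<nu>1 / \<mu>1) ^ cyc_add l2 s 1 * y)" for y
      unfolding mu2_q t1 using nonzero by (simp add: field_simps)
    finally show ?thesis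
      using ab X12 by (simp add: w_def flip: s_def)
  next
    case X21
    have "(\<nu>1 / \<mu>1) ^ s * (\<mu>1 * \<alpha> ^ a * y) =
        \<nu>1 * \<alpha> ^ a * ((\<nu>1 / \<mu>1) ^ cyc_add l2 s (- 1) * y)" for y
      unfolding t2 using nonzero by (simp add: field_simps)
    then show ?thesis
      using ab X21 by (simp add: w_def flip: s_def)
  next
    case X22
    then show ?thesis
      using ab by (simp add: w_def s_def)
  qed
qed

lemma V3_isomorphicI:
  assumes nonzero: "\<mu>1 \<noteq> 0" "\<nu>1 \<noteq> 0"
    and mu: "\<mu>1 ^ l2 = \<nu>1 ^ l2" "\<mu>2 = \<nu>2 * q ^ v"
  shows "right_module_isomorphic (M2 \<alpha> \<beta>) (V3 \<alpha> \<beta> \<mu>1 \<mu>2) (V3 \<alpha> \<beta> \<nu>1 \<nu>2)"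
proof -
  let ?V = "V3 \<alpha> \<beta> \<mu>1 \<mu>2" and ?W = "V3 \<alpha> \<beta> \<nu>1 \<nu>2"
  define w where "w = (\<lambda>b. (\<nu>1 / \<mu>1) ^ cyc_add l2 b (- int v))"
  define h where "h = weighted_shift \<alpha> \<beta> (- int v) w"
  \<comment> \<open>The weight of \<open>h\<close> at \<open>b\<close> has the source index as
    exponent, so the inverse shift must divide by \<open>t ^ b\<close> at its own target
    \<open>b\<close>, where \<open>t = \<nu>1 / \<mu>1\<close>.\<close>
  define w' where "w' = (\<lambda>b. inverse ((\<nu>1 / \<mu>1) ^ b))"
  define h' where "h' = weighted_shift \<alpha> \<beta> (int v) w'"
  have h_op: "h (V3_op \<alpha> \<beta> \<mu>1 \<mu>2 g x) = V3_op \<alpha> \<beta> \<nu>1 \<nu>2 g (h x)" for g x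
    unfolding h_def w_def using weighted_shift_V3_op[OF nonzero mu] .
  \<comment> \<open>Intertwining passes from generators to words, then by linearity to the free
    algebra, and finally to cosets.\<close>
  have h_fold: "h (fold (V3_op \<alpha> \<beta> \<mu>1 \<mu>2) ws x) = fold (V3_op \<alpha> \<beta> \<nu>1 \<nu>2) ws (h x)" for ws x
    by (induction ws arbitrary: x) (simp_all add: h_op)
  have h_act: "h (V3_free_act \<alpha> \<beta> \<mu>1 \<mu>2 r x) = V3_free_act \<alpha> \<beta> \<nu>1 \<nu>2 r (h x)" for r x
  proof (induction r rule: free_alg_induct)
    case (single u c)
    show ?case
      by (simp add: V3_free_act_single h_fold[symmetric]) (simp add: h_def weighted_shift_scale)
  next
    case (add r s)
    then show ?case by (simp add: V3_free_act_add_ring) (simp add: h_def weighted_shift_add)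
  qed
  have closed: "h x \<in> carrier ?W" "h' x \<in> carrier ?V" for x
    by (simp_all add: h_def h'_def weighted_shift_carrier)
  have "h' (h x) = x" if "x \<in> carrier ?V" for x
    using weighted_shift_inverse[OF that, of w' w "int v"] nonzero ord_pos
    by (simp add: h_def h'_def w_def w'_def cyc_add_cyc_add cyc_add_mod)
  moreover have "h (h' x) = x" if "x \<in> carrier ?W" for x
    using weighted_shift_inverse[OF that, of w w' "- int v"] nonzero
    by (simp add: h_def h'_def w_def w'_def)
  ultimately have "bij_betw h (carrier ?V) (carrier ?W)"
    using closed by (intro bij_betwI[where g = h']) auto
  moreover have "h \<in> right_module_hom (M2 \<alpha> \<beta>) ?V ?W"
  proof -
    have "h (x \<oplus>\<^bsub>?V\<^esub> y) = h x \<oplus>\<^bsub>?W\<^esub> h y" for x y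
      by (simp add: V3_def h_def weighted_shift_add)
    moreover have "h (r \<odot>\<^bsub>?V\<^esub> x) = r \<odot>\<^bsub>?W\<^esub> h x"
      if "r \<in> carrier (M2 \<alpha> \<beta>)" "x \<in> carrier ?V" for r x
      using that closed nonzero by (auto simp: M2_carrier_class V3_class_action h_act)
    ultimately show ?thesis using closed by (simp add: right_module_hom_def)
  qed
  ultimately show ?thesis unfolding right_module_isomorphic_def by blast
qed

end

section \<open>Positivity of the two orders and the equivalence\<close>

theorem theorem7p3:
  fixes \<alpha> \<beta> \<mu>1 \<mu>2 lam1 lam2 :: "'k::alg_closed_field"
  assumes "\<alpha> \<noteq> 0" and "\<beta> \<noteq> 0"
    and "\<exists>m>0. \<alpha> ^ m = 1" and "\<exists>n>0. \<beta> ^ n = 1"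
    and "\<alpha> * \<beta> \<noteq> 1"
    and "\<mu>1 \<noteq> 0" and "\<mu>2 \<noteq> 0" and "lam1 \<noteq> 0" and "lam2 \<noteq> 0"
  shows "right_module_isomorphic (M2 \<alpha> \<beta>) (V3 \<alpha> \<beta> \<mu>1 \<mu>2) (V3 \<alpha> \<beta> lam1 lam2) \<longleftrightarrow>
    (let l2 = unit_ord (\<alpha> * inverse \<beta>)
     in \<exists>v::nat. v \<le> l2 - 1 \<and> \<mu>1 ^ l2 = lam1 ^ l2 \<and> \<mu>2 = lam2 * (inverse \<alpha> * \<beta>) ^ v)"
proof -
  obtain m n where mn: "m > 0" "\<alpha> ^ m = 1" "n > 0" "\<beta> ^ n = 1"
    using assms(3,4) by blast
  \<comment> \<open>The common exponent \<open>m * n\<close> annihilates both roots of unity, hence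
    also their product and quotient.\<close>
  have powers: "\<alpha> ^ (m * n) = 1" "\<beta> ^ (m * n) = 1"
    using mn power_mult[of \<alpha> m n] power_mult[of \<beta> n m] by (simp_all add: mult.commute)
  have ord_pos: "unit_ord (\<alpha> * \<beta>) > 0" "unit_ord (\<alpha> * inverse \<beta>) > 0"
    using assms(1,2) mn powers
    by (auto intro!: unit_ord_pos[of _ "m * n"] simp: power_mult_distrib power_inverse)
  show ?thesis (is "?iso \<longleftrightarrow> ?rel")
  proof
    assume ?iso
    then show ?rel
      using V3_isomorphic_imp[OF assms(1,2) ord_pos assms(6-9)]
      \<comment> \<open>Since \<open>l2 > 0\<close>, the bounds \<open>v < l2\<close> and
        \<open>v \<le> l2 - 1\<close> agree despite truncated subtraction.\<close>
      unfolding Let_def by (metis Suc_pred' less_Suc_eq_le ord_pos(2))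
  next
    assume ?rel
    then obtain v where
      "\<mu>1 ^ unit_ord (\<alpha> * inverse \<beta>) = lam1 ^ unit_ord (\<alpha> * inverse \<beta>)"
      "\<mu>2 = lam2 * (inverse \<alpha> * \<beta>) ^ v"
      unfolding Let_def by blast
    then show ?iso
      by (rule V3_isomorphicI[OF assms(1,2) ord_pos assms(6,8)])
  qed
qed

end
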